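(* Let $P$ be a $3$-dimensional reflexive polytope with $\delta$-vector $(1,\delta_1,\delta_1,1)$. Then either (i) the roots of $L_P$ are $\{-1/2,-1/2\pm bi\}$ for some $b\in\mathbb{R}$, i.e. $P$ is a CL-polytope, or (ii) the roots of $L_P$ are $\{-1/2,a,-1-a\}$ for some $a\in\mathbb{R}$, i.e. $P$ is real. Furthermore, the following four conditions are equivalent: (ia) $P$ is a CL-polytope; (ib) $\delta_1\leq 23$; (ic) $\operatorname{vol}(P)\leq 8$; (id) $|P\cap\mathbb{Z}^3|\leq 27$. Likewise, the following four conditions are equivalent: (iia) $P$ is real; (iib) $\delta_1\geq 23$; (iic) $\operatorname{vol}(P)\geq 8$; (iid) $|P\cap\mathbb{Z}^3|\geq 27$. In addition, in case (ii) one has $-1<a<0$, so that every root $z$ of $L_P$ satisfies $-1<\operatorname{Re}(z)<0$.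
   Context: A $d$-dimensional lattice polytope is a full-dimensional convex polytope $P\subset\mathbb{Z}^d\otimes_{\mathbb{Z}}\mathbb{Q}$ with vertices in $\mathbb{Z}^d$. It is reflexive if its dual $P^*:=\{u\in\mathbb{Z}^d\otimes_{\mathbb{Z}}\mathbb{Q}\mid\langle u,v\rangle\geq -1\text{ for all }v\in P\}$ is also a lattice polytope. $\operatorname{vol}(P)$ denotes the usual (non-normalised) Euclidean volume. The Ehrhart polynomial $L_P$ is the degree-$d$ polynomial with $L_P(m)=|mP\cap\mathbb{Z}^d|$ for all integers $m\geq 0$, regarded as a polynomial over $\mathbb{C}$. The $\delta$-vector $(\delta_0,\ldots,\delta_d)$ of $P$ is defined by $\sum_{m\geq 0}L_P(m)t^m=\frac{\delta_0+\delta_1t+\cdots+\delta_dt^d}{(1-t)^{d+1}}$; for reflexive $P$ it is palindromic with $\delta_0=1$. $P$ is a CL-polytope if every root $z\in\mathbb{C}$ of $L_P$ satisfies $\operatorname{Re}(z)=-1/2$, and $P$ is real if every root satisfies $\operatorname{Im}(z)=0$. *)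

theory Defs
  imports "HOL-Analysis.Analysis" "HOL-Computational_Algebra.Polynomial_FPS"
begin

(* Polytopes are taken over the reals rather than the rationals: a lattice polytope is
   determined by its vertices, and its volume, lattice points and dual are the same. *)

definition integer_lattice :: "(real ^ 'n) set" where
  "integer_lattice = {x. \<forall>i. x $ i \<in> \<int>}"

definition lattice_polytope :: "(real ^ 'n) set \<Rightarrow> bool" where
  "lattice_polytope P \<longleftrightarrow>
     polytope P \<and> aff_dim P = int CARD('n) \<and> (\<forall>v. v extreme_point_of P \<longrightarrow> v \<in> integer_lattice)"

definition dual_polytope :: "(real ^ 'n) set \<Rightarrow> (real ^ 'n) set" where
  "dual_polytope P = {u. \<forall>v\<in>P. u \<bullet> v \<ge> -1}"

definition reflexive_polytope :: "(real ^ 'n) set \<Rightarrow> bool" where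
  "reflexive_polytope P \<longleftrightarrow> lattice_polytope P \<and> lattice_polytope (dual_polytope P)"

definition lattice_point_count :: "(real ^ 'n) set \<Rightarrow> nat \<Rightarrow> nat" where
  "lattice_point_count P m = card ((*\<^sub>R) (real m) ` P \<inter> integer_lattice)"

definition ehrhart_poly :: "(real ^ 'n) set \<Rightarrow> complex poly" where
  "ehrhart_poly P =
     (THE L. degree L = CARD('n) \<and> (\<forall>m. poly L (of_nat m) = of_nat (lattice_point_count P m)))"

(* The coefficients of the Ehrhart series are written as lattice point counts, which are the
   values of the Ehrhart polynomial at 0, 1, 2, ...  In this way the notion does not depend
   on the existence of that polynomial. *)
definition is_delta_vector :: "(real ^ 'n) set \<Rightarrow> int list \<Rightarrow> bool" where
  "is_delta_vector P \<delta> \<longleftrightarrow>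
     length \<delta> = CARD('n) + 1 \<and>
     Abs_fps (\<lambda>m. of_nat (lattice_point_count P m) :: complex) =
       fps_of_poly (Poly (map of_int \<delta>)) / (1 - fps_X) ^ (CARD('n) + 1)"

definition CL_polytope :: "(real ^ 'n) set \<Rightarrow> bool" where
  "CL_polytope P \<longleftrightarrow> (\<forall>z. poly (ehrhart_poly P) z = 0 \<longrightarrow> Re z = - 1 / 2)"

definition real_polytope :: "(real ^ 'n) set \<Rightarrow> bool" where
  "real_polytope P \<longleftrightarrow> (\<forall>z. poly (ehrhart_poly P) z = 0 \<longrightarrow> Im z = 0)"

lemma ehrhart_poly_eqI:
  fixes P :: "(real ^ 'n) set"
  assumes "degree L = CARD('n)"
    and "\<And>m. poly L (of_nat m) = of_nat (lattice_point_count P m)"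
  shows "ehrhart_poly P = L"
  unfolding ehrhart_poly_def
proof (rule the_equality)
  show "degree L = CARD('n) \<and> (\<forall>m. poly L (of_nat m) = of_nat (lattice_point_count P m))"
    using assms by simp
next
  fix L' :: "complex poly"
  assume "degree L' = CARD('n) \<and> (\<forall>m. poly L' (of_nat m) = of_nat (lattice_point_count P m))"
  then have "range of_nat \<subseteq> {z. poly (L' - L) z = 0}"
    using assms(2) by auto
  moreover have "infinite (range (of_nat :: nat \<Rightarrow> complex))"
    by (simp add: finite_image_iff inj_of_nat)
  ultimately have "infinite {z. poly (L' - L) z = 0}"
    using infinite_super by blast
  then show "L' = L"
    using poly_roots_finite[of "L' - L"] by (cases "L' - L = 0") simp_all
qed

lemma is_delta_vector_unique:
  fixes P :: "(real ^ 'n) set"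
  assumes "is_delta_vector P \<delta>" and "is_delta_vector P \<delta>'"
  shows "\<delta> = \<delta>'"
proof -
  let ?f = "\<lambda>\<delta>. fps_of_poly (Poly (map of_int \<delta>)) :: complex fps"
  let ?u = "(1 - fps_X) ^ (CARD('n) + 1) :: complex fps"
  have u: "fps_nth ?u 0 \<noteq> 0"
    by simp
  have "?f \<delta> / ?u = ?f \<delta>' / ?u"
    using assms by (simp add: is_delta_vector_def)
  then have "?f \<delta> * inverse ?u * ?u = ?f \<delta>' * inverse ?u * ?u"
    by (simp only: fps_divide_unit[OF u])
  then have "?f \<delta> = ?f \<delta>'"
    using inverse_mult_eq_1[OF u] by (simp only: mult.assoc mult_1_right)
  then have nth: "nth_default 0 (map of_int \<delta>) i = (nth_default 0 (map of_int \<delta>') i :: complex)" for i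
    by (metis fps_of_poly_nth coeff_Poly_eq)
  have len: "length \<delta> = length \<delta>'"
    using assms by (simp add: is_delta_vector_def)
  show ?thesis
  proof (rule nth_equalityI[OF len])
    fix i assume "i < length \<delta>"
    then show "\<delta> ! i = \<delta>' ! i"
      using nth[of i] len by (simp add: nth_default_def)
  qed
qed

end

(* The delta-vector (1, d, d, 1) gives 6 L(m) = (2 m + 1) ((d + 1) (m^2 + m) + 6), so the roots
   are -1/2 and the two roots of z (1 + z) = - 6 / (d + 1); its discriminant changes sign at
   d = 23, and the product 6 / (d + 1) > 0 of the two roots confines real roots to (-1, 0).
   Moreover L(1) = d + 4, and vol P = lim L(m) / m^3 = (d + 1) / 3; the latter is where d > -1
   comes from. *)
theory Submission
  imports Defs
begin

section \<open>Lattice point counts from the delta-vector\<close>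

text \<open>Coefficient comparison: \<open>1 / (1 - t) ^ (d + 1)\<close> has the coefficients
  \<open>(k + d) choose d\<close>, and the formula is the Cauchy product with the numerator.\<close>

lemma lattice_point_count_delta_vector:
  fixes P :: "(real ^ 'n) set"
  assumes "is_delta_vector P \<delta>"
  shows "int (lattice_point_count P m) =
    (\<Sum>j\<le>CARD('n). \<delta> ! j * int ((m + CARD('n) - j) choose CARD('n)))"
proof -
  let ?d = "CARD('n)"
  let ?N = "Abs_fps (\<lambda>m. of_nat (lattice_point_count P m)) :: complex fps"
  have len: "length \<delta> = ?d + 1"
    and N: "?N = fps_of_poly (Poly (map of_int \<delta>)) / (1 - fps_X) ^ (?d + 1)"
    using assms by (simp_all add: is_delta_vector_def)
  have inv: "inverse ((1 - fps_X) ^ (?d + 1) :: complex fps) = Abs_fps (\<lambda>k. of_nat ((k + ?d) choose ?d))"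
  proof -
    have "(?d + 1 + k - 1) choose k = (k + ?d) choose ?d" for k
      using binomial_symmetric[of k "k + ?d"] by (simp add: add.commute)
    then show ?thesis
      using one_minus_const_fps_X_neg_power'[of "?d + 1" "1::complex"] by (simp only:) simp
  qed
  have coeff: "nth_default 0 (map of_int \<delta>) j = (if j \<le> ?d then of_int (\<delta> ! j) else 0 :: complex)" for j
    using len by (simp add: nth_default_def)
  have "of_nat (lattice_point_count P m) = fps_nth ?N m"
    by simp
  also have "\<dots> = fps_nth (fps_of_poly (Poly (map of_int \<delta>)) * Abs_fps (\<lambda>k. of_nat ((k + ?d) choose ?d))) m"
    by (subst N, subst fps_divide_unit, simp, simp only: inv)
  also have "\<dots> = (\<Sum>j=0..m. (if j \<le> ?d then of_int (\<delta> ! j) else 0) * of_nat ((m - j + ?d) choose ?d))"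
    by (simp add: fps_mult_nth coeff)
  also have "\<dots> = (\<Sum>j\<in>{0..m} \<inter> {..?d}. of_int (\<delta> ! j) * of_nat ((m - j + ?d) choose ?d))"
    by (rule sum.mono_neutral_cong_right) auto
  \<comment> \<open>The new terms have \<open>m < j\<close> and \<open>j \<le> ?d\<close>, so that
    \<open>m + ?d - j < ?d\<close> and the binomial vanishes. The order of the operations matters:
    there \<open>m - j + ?d\<close> would truncate to \<open>?d\<close> and give 1.\<close>
  also have "\<dots> = (\<Sum>j\<le>?d. of_int (\<delta> ! j) * of_nat ((m + ?d - j) choose ?d))"
    by (rule sum.mono_neutral_cong_left) (auto intro!: binomial_eq_0)
  finally have "of_int (int (lattice_point_count P m)) =
    (of_int (\<Sum>j\<le>?d. \<delta> ! j * int ((m + ?d - j) choose ?d)) :: complex)"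
    by simp
  then show ?thesis
    by (simp only: of_int_eq_iff)
qed

lemma binomial_3: "6 * of_nat (n choose 3) = (of_nat n * (of_nat n - 1) * (of_nat n - 2) :: 'a::field_char_0)"
  by (simp add: binomial_gbinomial gbinomial_prod_rev eval_nat_numeral field_simps)

section \<open>Volume as the limit of scaled lattice point counts\<close>

definition lattice_floor :: "real ^ 'n \<Rightarrow> real ^ 'n" where
  "lattice_floor x = (\<chi> i. of_int \<lfloor>x $ i\<rfloor>)"

lemma lattice_floor_in_lattice: "lattice_floor x \<in> integer_lattice"
  by (simp add: lattice_floor_def integer_lattice_def)

text \<open>Identifies the fibres of \<open>lattice_floor\<close> as half-open unit cubes anchored
  at lattice points. They tile the space, so counting lattice points becomes measuring a union of
  cubes.\<close>

lemma lattice_floor_eq_iff: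
  assumes "y \<in> integer_lattice"
  shows "lattice_floor x = y \<longleftrightarrow> (\<forall>i. y $ i \<le> x $ i \<and> x $ i < y $ i + 1)"
proof -
  have "of_int \<lfloor>x $ i\<rfloor> = y $ i \<longleftrightarrow> y $ i \<le> x $ i \<and> x $ i < y $ i + 1" for i
  proof -
    obtain k where "y $ i = of_int k"
      using assms by (auto simp: integer_lattice_def elim: Ints_cases)
    then show ?thesis
      by (simp add: floor_eq_iff)
  qed
  then show ?thesis
    by (simp add: lattice_floor_def vec_eq_iff)
qed

lemma finite_bounded_lattice:
  fixes A :: "(real ^ 'n) set"
  assumes "bounded A"
  shows "finite (A \<inter> integer_lattice)"
proof -
  obtain B where B: "\<And>x. x \<in> A \<Longrightarrow> norm x \<le> B"
    using assms by (auto simp: bounded_iff)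
  let ?I = "{k::real. k \<in> \<int> \<and> \<bar>k\<bar> \<le> B}"
  have "finite (vec_lambda ` (UNIV \<rightarrow>\<^sub>E ?I) :: (real ^ 'n) set)"
    by (intro finite_imageI finite_PiE finite_abs_int_segment finite)
  moreover have "A \<inter> integer_lattice \<subseteq> vec_lambda ` (UNIV \<rightarrow>\<^sub>E ?I)"
  proof
    fix x assume "x \<in> A \<inter> integer_lattice"
    then have "vec_nth x \<in> UNIV \<rightarrow>\<^sub>E ?I"
      using B by (auto simp: integer_lattice_def intro: order_trans[OF component_le_norm_cart])
    then show "x \<in> vec_lambda ` (UNIV \<rightarrow>\<^sub>E ?I)"
      by (intro image_eqI[of _ _ "vec_nth x"]) simp_all
  qed
  ultimately show ?thesis
    using finite_subset by blast
qed

text \<open>Each coordinate moves by less than 1. The crude l1 bound suffices, since it will be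
  divided by \<open>m\<close>.\<close>

lemma norm_diff_lattice_floor_le:
  fixes x :: "real ^ 'n"
  shows "norm (x - lattice_floor x) \<le> CARD('n)"
proof -
  have "norm (x - lattice_floor x) \<le> (\<Sum>i\<in>UNIV. \<bar>(x - lattice_floor x) $ i\<bar>)"
    by (rule norm_le_l1_cart)
  also have "\<dots> \<le> (\<Sum>i\<in>(UNIV::'n set). 1)"
    by (rule sum_mono) (auto simp: lattice_floor_def, linarith)
  finally show ?thesis
    by simp
qed

text \<open>The cell is a half-open cube of side \<open>1 / m\<close>, squeezed between the open and
  the closed box with the same corners, which have equal measure.\<close>

lemma lattice_floor_cell:
  fixes y :: "real ^ 'n"
  assumes y: "y \<in> integer_lattice" and m: "m > 0"
  defines "C \<equiv> {x. lattice_floor (real m *\<^sub>R x) = y}"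
  shows "C \<in> sets lborel" and "emeasure lborel C = ennreal (1 / real m ^ CARD('n))"
proof -
  have C: "C = (\<Inter>i. {x. y $ i \<le> real m * x $ i} \<inter> {x. real m * x $ i < y $ i + 1})"
    using lattice_floor_eq_iff[OF y] by (auto simp: C_def)
  have "{x. y $ i \<le> real m * x $ i} \<in> sets borel" "{x. real m * x $ i < y $ i + 1} \<in> sets borel" for i
    by (intro borel_closed borel_open closed_Collect_le open_Collect_less continuous_intros)+
  then show sets: "C \<in> sets lborel"
    unfolding C by (auto intro!: sets.countable_INT'')
  \<comment> \<open>In \<open>y + 1\<close> the summand is the all-ones vector.\<close>
  let ?a = "(1 / real m) *\<^sub>R y" and ?b = "(1 / real m) *\<^sub>R (y + 1)"
  have sub: "box ?a ?b \<subseteq> C" "C \<subseteq> cbox ?a ?b"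
    using m by (auto simp: C mem_box_cart field_simps less_imp_le)
  have vol: "(\<Prod>b\<in>Basis. (?b - ?a) \<bullet> b) = 1 / real m ^ CARD('n)"
  proof -
    have "(?b - ?a) \<bullet> b = 1 / real m" if "b \<in> Basis" for b
      using that by (auto simp: algebra_simps Basis_vec_def inner_axis)
    then have "(\<Prod>b\<in>Basis. (?b - ?a) \<bullet> b) = (\<Prod>b\<in>(Basis :: (real ^ 'n) set). 1 / real m)"
      by (intro prod.cong) auto
    then show ?thesis
      by (simp add: power_one_over)
  qed
  have le: "?a \<bullet> b \<le> ?b \<bullet> b" if "b \<in> Basis" for b
    using that m by (auto simp: Basis_vec_def inner_axis field_simps)
  have "emeasure lborel (box ?a ?b) \<le> emeasure lborel C" "emeasure lborel C \<le> emeasure lborel (cbox ?a ?b)"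
    using sub sets by (auto intro!: emeasure_mono)
  then show "emeasure lborel C = ennreal (1 / real m ^ CARD('n))"
    using le by (simp add: vol)
qed

text \<open>The quotient is the integral of the indicator of \<open>P\<close> evaluated at \<open>x\<close> rounded down to the
  lattice scaled by \<open>1 / m\<close>. This converges pointwise off the frontier, so dominated convergence applies.\<close>

lemma lattice_point_count_asymptotics:
  fixes P :: "(real ^ 'n) set"
  assumes "compact P" and "negligible (frontier P)"
  shows "(\<lambda>m. real (lattice_point_count P m) / real m ^ CARD('n)) \<longlonglongrightarrow> measure lborel P"
proof -
  \<comment> \<open>\<open>S m\<close> is the disjoint union of the cells \<open>C m y\<close> over
    the lattice points \<open>y\<close> of the dilate, so its measure is the quotient in
    question.\<close>
  define S where "S m = {x. lattice_floor (real m *\<^sub>R x) \<in> (*\<^sub>R) (real m) ` P}" for m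
  define K where "K m = (*\<^sub>R) (real m) ` P \<inter> integer_lattice" for m
  define C where "C m y = {x. lattice_floor (real m *\<^sub>R x) = y}" for m and y :: "real ^ 'n"
  have fin: "finite (K m)" for m
    unfolding K_def using assms(1) by (intro finite_bounded_lattice compact_imp_bounded compact_scaling)
  have S: "S m = (\<Union>y\<in>K m. C m y)" for m
    using lattice_floor_in_lattice by (auto simp: S_def K_def C_def)
  have C: "C m y \<in> sets lborel" "emeasure lborel (C m y) = ennreal (1 / real m ^ CARD('n))"
    if "y \<in> K m" "m > 0" for m y
    using that lattice_floor_cell[of y m] by (auto simp: K_def C_def)
  have sets_S: "S m \<in> sets lborel" if "m > 0" for m
    unfolding S using fin C that by blast
  have measure_S: "measure lborel (S m) = real (lattice_point_count P m) / real m ^ CARD('n)" if "m > 0" for m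
  proof -
    have "emeasure lborel (S m) = (\<Sum>y\<in>K m. emeasure lborel (C m y))"
      unfolding S using fin C that
      by (intro sum_emeasure[symmetric]) (auto simp: disjoint_family_on_def C_def)
    also have "\<dots> = (\<Sum>y\<in>K m. ennreal (1 / real m ^ CARD('n)))"
      using C that by (intro sum.cong) auto
    also have "\<dots> = ennreal (card (K m) / real m ^ CARD('n))"
      by (subst sum_ennreal) (auto)
    finally show ?thesis
      by (simp add: measure_def lattice_point_count_def K_def)
  qed
  obtain B where B: "\<And>x. x \<in> P \<Longrightarrow> norm x \<le> B"
    using compact_imp_bounded[OF assms(1)] by (auto simp: bounded_iff)
  define r where "r m x = (1 / real m) *\<^sub>R lattice_floor (real m *\<^sub>R x)" for m and x :: "real ^ 'n"
  have S_iff: "x \<in> S m \<longleftrightarrow> r m x \<in> P" if "m > 0" for m x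
    using that by (force simp: S_def r_def image_iff)
  have r_close: "norm (x - r m x) \<le> CARD('n) / real m" if "m > 0" for m x
  proof -
    have "x - r m x = (1 / real m) *\<^sub>R (real m *\<^sub>R x - lattice_floor (real m *\<^sub>R x))"
      using that by (simp add: r_def algebra_simps)
    then have "norm (x - r m x) = (1 / real m) * norm (real m *\<^sub>R x - lattice_floor (real m *\<^sub>R x))"
      by simp
    then show ?thesis
      using norm_diff_lattice_floor_le[of "real m *\<^sub>R x"] that by (simp add: divide_right_mono)
  qed
  \<comment> \<open>The index is shifted to \<open>Suc m\<close> because the facts on
    \<open>S\<close> and \<open>r\<close> hold for positive \<open>m\<close> only; the shift is
    undone at the very end.\<close>
  have r_lim: "(\<lambda>m. r (Suc m) x) \<longlonglongrightarrow> x" for x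
  proof (rule LIM_zero_cancel, rule Lim_null_comparison)
    show "\<forall>\<^sub>F m in sequentially. norm (r (Suc m) x - x) \<le> CARD('n) / real (Suc m)"
      using r_close[of "Suc _" x] by (simp add: norm_minus_commute)
    show "(\<lambda>m. CARD('n) / real (Suc m)) \<longlonglongrightarrow> 0"
      by (rule LIMSEQ_Suc[OF lim_const_over_n])
  qed
  \<comment> \<open>One ball for all \<open>m\<close>: its indicator is the integrable dominating
    function.\<close>
  have bound: "S (Suc m) \<subseteq> cball 0 (B + CARD('n))" for m
  proof
    fix x assume "x \<in> S (Suc m)"
    then have "norm (r (Suc m) x) \<le> B"
      using B S_iff by simp
    moreover have "CARD('n) / real (Suc m) \<le> CARD('n)"
      by (simp add: divide_le_eq)
    ultimately have "norm (r (Suc m) x + (x - r (Suc m) x)) \<le> B + CARD('n)"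
      using r_close[of "Suc m" x] by (intro order_trans[OF norm_triangle_ineq]) linarith
    then show "x \<in> cball 0 (B + CARD('n))"
      by simp
  qed
  have P_sets: "P \<in> sets lborel"
    using assms(1) by (simp add: compact_imp_closed)
  have "(\<lambda>m. integral\<^sup>L lborel (indicator (S (Suc m)) :: _ \<Rightarrow> real)) \<longlonglongrightarrow> integral\<^sup>L lborel (indicator P :: _ \<Rightarrow> real)"
  proof (rule integral_dominated_convergence[where w = "indicator (cball 0 (B + CARD('n)))"])
    have "frontier P \<in> null_sets lborel"
      using assms(2) by (simp add: negligible_iff_null_sets null_sets_def emeasure_completion[symmetric])
    then have "AE x in lborel. x \<notin> frontier P"
      by (rule AE_not_in)
    then show "AE x in lborel. (\<lambda>m. indicator (S (Suc m)) x :: real) \<longlonglongrightarrow> indicator P x"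
    proof eventually_elim
      case (elim x)
      \<comment> \<open>As \<open>P\<close> is closed, a point off the frontier lies in one of two
        open sets, and the rounded points eventually stay in the same one.\<close>
      have "x \<in> interior P \<or> x \<in> - P"
        using elim assms(1) by (auto simp: frontier_def compact_imp_closed)
      moreover have "open (interior P)" "open (- P)"
        using assms(1) by (auto simp: compact_imp_closed)
      ultimately have "\<forall>\<^sub>F m in sequentially. r (Suc m) x \<in> P \<longleftrightarrow> x \<in> P"
      proof (elim disjE)
        assume x: "x \<in> interior P"
        show ?thesis
          using topological_tendstoD[OF r_lim \<open>open (interior P)\<close> x] x interior_subset[of P]
          by (auto elim!: eventually_mono)
      next
        assume x: "x \<in> - P"
        show ?thesis
          using topological_tendstoD[OF r_lim \<open>open (- P)\<close> x] x by (auto elim!: eventually_mono)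
      qed
      then show ?case
        by (intro tendsto_eventually) (auto elim!: eventually_mono simp: indicator_def S_iff)
    qed
  next
    show "integrable lborel (indicator (cball 0 (B + CARD('n))) :: real ^ 'n \<Rightarrow> real)"
      by (intro integrable_real_indicator emeasure_lborel_cball_finite) simp
  next
    show "AE x in lborel. norm (indicator (S (Suc m)) x :: real) \<le> indicator (cball 0 (B + CARD('n))) x" for m
      using bound[of m] by (intro AE_I2) (auto simp: indicator_def)
  qed (use P_sets sets_S in auto)
  then have "(\<lambda>m. real (lattice_point_count P (Suc m)) / real (Suc m) ^ CARD('n)) \<longlonglongrightarrow> measure lborel P"
    using P_sets sets_S by (simp add: measure_S del: of_nat_Suc)
  then show ?thesis
    by (rule LIMSEQ_imp_Suc)
qed

text \<open>Full dimension makes the relative interior of a nonempty convex set its interior, and a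
  convex set with interior points is not negligible.\<close>

lemma measure_pos_convex_full_dim:
  fixes P :: "'a::euclidean_space set"
  assumes "compact P" "convex P" "aff_dim P = DIM('a)"
  shows "measure lborel P > 0"
proof -
  have "P \<noteq> {}"
    using assms(3) by force
  then have "interior P \<noteq> {}"
    using assms(2,3) interior_rel_interior rel_interior_eq_empty by metis
  then have "\<not> negligible P"
    using assms(2) negligible_convex_interior by blast
  moreover have "P \<in> lmeasurable"
    using assms(1) lmeasurable_compact by blast
  ultimately have "measure lebesgue P \<noteq> 0"
    using negligible_iff_measure0 by blast
  moreover have "measure lebesgue P = measure lborel P"
    using assms(1) by (simp add: compact_imp_closed)
  ultimately show ?thesis
    using measure_nonneg[of lborel P] by linarith
qed

section \<open>The delta-vector (1, d, d, 1) in dimension three\<close>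

text \<open>The multiple 6 clears the denominators of the cubic binomials. The factor
  \<open>2 * int m + 1\<close> reflects palindromicity: the cubic changes sign under
  \<open>m\<close> to \<open>- 1 - m\<close>.\<close>

lemma lattice_point_count_palindromic:
  fixes P :: "(real ^ 3) set"
  assumes "is_delta_vector P [1, d, d, 1]"
  shows "6 * int (lattice_point_count P m) = (2 * int m + 1) * ((d + 1) * (int m ^ 2 + int m) + 6)"
proof -
  \<comment> \<open>Subtraction is that of \<open>int\<close>, and for \<open>n < 3\<close> one of
    the factors is 0, so small \<open>n\<close> need no special case.\<close>
  have b: "6 * int (n choose 3) = int n * (int n - 1) * (int n - 2)" for n
  proof -
    have "(of_int (6 * int (n choose 3)) :: real) = of_int (int n * (int n - 1) * (int n - 2))"
      using binomial_3[of n, where 'a = real] by simp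
    then show ?thesis
      by (simp only: of_int_eq_iff)
  qed
  have "int (lattice_point_count P m) =
      int ((m + 3) choose 3) + d * int ((m + 2) choose 3) + d * int ((m + 1) choose 3) + int (m choose 3)"
    using lattice_point_count_delta_vector[OF assms, of m]
    by (simp add: numeral_3_eq_3 atMost_Suc)
  then have "6 * int (lattice_point_count P m) =
      6 * int ((m + 3) choose 3) + d * (6 * int ((m + 2) choose 3)) + d * (6 * int ((m + 1) choose 3))
        + 6 * int (m choose 3)"
    by simp
  also have "\<dots> = (2 * int m + 1) * ((d + 1) * (int m ^ 2 + int m) + 6)"
    unfolding b by (simp add: algebra_simps power2_eq_square)
  finally show ?thesis .
qed

lemma measure_palindromic:
  fixes P :: "(real ^ 3) set"
  assumes "compact P" and "negligible (frontier P)" and "is_delta_vector P [1, d, d, 1]"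
  shows "measure lborel P = of_int (d + 1) / 3"
proof -
  have count: "real (lattice_point_count P m) = (2 * real m + 1) * ((d + 1) * (real m ^ 2 + real m) + 6) / 6" for m
    using lattice_point_count_palindromic[OF assms(3), of m, THEN arg_cong[where f = real_of_int]] by simp
  \<comment> \<open>\<open>g\<close> is the cubic divided by \<open>m ^ 3\<close>, written in
    \<open>x = 1 / m\<close>; being continuous at 0, it turns the limit into the evaluation
    \<open>g 0\<close>.\<close>
  define g where "g x = (2 + x) * ((d + 1) * (1 + x) + 6 * x ^ 2) / 6" for x :: real
  have "isCont g 0"
    unfolding g_def by (intro continuous_intros) simp
  then have "(\<lambda>m. g (1 / real m)) \<longlonglongrightarrow> g 0"
    using lim_1_over_n by (rule isCont_tendsto_compose)
  also have "g 0 = (d + 1) / 3"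
    by (simp add: g_def)
  finally have "(\<lambda>m. real (lattice_point_count P m) / real m ^ CARD(3)) \<longlonglongrightarrow> (d + 1) / 3"
  proof (rule Lim_transform_eventually)
    show "\<forall>\<^sub>F m in sequentially. g (1 / real m) = real (lattice_point_count P m) / real m ^ CARD(3)"
      using eventually_gt_at_top[of 0]
      by eventually_elim (simp add: g_def count field_simps power2_eq_square power3_eq_cube)
  qed
  then show ?thesis
    by (rule LIMSEQ_unique[OF lattice_point_count_asymptotics[OF assms(1,2)]])
qed

text \<open>The quadratic factor has root sum -1, so one root \<open>r\<close> determines the other
  as \<open>- 1 - r\<close>. The product of the roots is prescribed without division, and
  \<open>r\<close> may be any complex solution.\<close>

lemma ehrhart_poly_palindromic:
  fixes P :: "(real ^ 3) set"
  assumes "is_delta_vector P [1, d, d, 1]" and "d \<noteq> -1" and "r * (1 + r) * of_int (d + 1) = - 6"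
  shows "ehrhart_poly P = smult (of_int (d + 1) / 3) ([:1/2, 1:] * [:- r, 1:] * [:1 + r, 1:])"
proof -
  define L where "L = smult (of_int (d + 1) / 3) ([:1/2, 1:] * [:- r, 1:] * [:1 + r, 1:])"
  have "of_int (d + 1) \<noteq> (0 :: complex)"
    using assms(2) by (metis add_eq_0_iff2 of_int_eq_0_iff)
  then have "degree L = CARD(3)"
    by (simp add: L_def degree_mult_eq)
  moreover have "poly L (of_nat m) = of_nat (lattice_point_count P m)" for m
  proof -
    let ?x = "of_nat m :: complex" and ?D = "of_int (d + 1) :: complex"
    \<comment> \<open>Uses \<open>(x - r) * (x + 1 + r) = x ^ 2 + x - r * (1 + r)\<close>.\<close>
    have "6 * poly L ?x = (2 * ?x + 1) * (?D * (?x ^ 2 + ?x) - r * (1 + r) * ?D)"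
      by (simp add: L_def algebra_simps power2_eq_square add_divide_distrib diff_divide_distrib)
    also have "\<dots> = (2 * ?x + 1) * (?D * (?x ^ 2 + ?x) + 6)"
      unfolding assms(3) by simp
    also have "\<dots> = 6 * of_nat (lattice_point_count P m)"
      using lattice_point_count_palindromic[OF assms(1), of m, THEN arg_cong[where f = complex_of_int]] by simp
    finally show ?thesis
      by simp
  qed
  ultimately show ?thesis
    unfolding L_def by (rule ehrhart_poly_eqI)
qed

text \<open>A multiset records multiplicities: for \<open>d = 23\<close> all three entries are
  -1/2.\<close>

lemma proots_ehrhart_poly_palindromic:
  fixes P :: "(real ^ 3) set"
  assumes "is_delta_vector P [1, d, d, 1]" and "d \<noteq> -1" and "r * (1 + r) * of_int (d + 1) = - 6"
  shows "proots (ehrhart_poly P) = {#- 1 / 2, r, - 1 - r#}"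
proof -
  have d: "of_int (d + 1) / 3 \<noteq> (0 :: complex)"
    using assms(2) by (metis add_eq_0_iff2 divide_eq_0_iff of_int_eq_0_iff zero_neq_numeral)
  have "proots (ehrhart_poly P) = proots ([:1/2, 1:] * [:- r, 1:] * [:1 + r, 1:])"
    unfolding ehrhart_poly_palindromic[OF assms] by (rule proots_smult[OF d])
  also have "\<dots> = {#- 1 / 2, r, - 1 - r#}"
    by (subst proots_mult, simp, simp, subst proots_mult, simp, simp) simp
  finally show ?thesis .
qed

section \<open>The dichotomy of the roots and its threshold\<close>

theorem proposition2p2:
  fixes P :: "(real ^ 3) set" and \<delta>1 :: int
  assumes "reflexive_polytope P" and "is_delta_vector P [1, \<delta>1, \<delta>1, 1]"
  shows
    "let L = ehrhart_poly P;
         case_i = (\<exists>b::real. proots L =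
           {#- 1 / 2, - 1 / 2 + of_real b * \<i>, - 1 / 2 - of_real b * \<i>#});
         case_ii = (\<exists>a::real. proots L = {#- 1 / 2, of_real a, - 1 - of_real a#})
     in (case_i \<or> case_ii) \<and>
        (case_i \<longleftrightarrow> CL_polytope P) \<and>
        (case_ii \<longleftrightarrow> real_polytope P) \<and>
        (CL_polytope P \<longleftrightarrow> \<delta>1 \<le> 23) \<and>
        (CL_polytope P \<longleftrightarrow> measure lborel P \<le> 8) \<and>
        (CL_polytope P \<longleftrightarrow> card (P \<inter> integer_lattice) \<le> 27) \<and>
        (real_polytope P \<longleftrightarrow> \<delta>1 \<ge> 23) \<and>
        (real_polytope P \<longleftrightarrow> measure lborel P \<ge> 8) \<and>
        (real_polytope P \<longleftrightarrow> card (P \<inter> integer_lattice) \<ge> 27) \<and>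
        (\<forall>a::real. proots L = {#- 1 / 2, of_real a, - 1 - of_real a#} \<longrightarrow> -1 < a \<and> a < 0) \<and>
        (case_ii \<longrightarrow> (\<forall>z. poly L z = 0 \<longrightarrow> -1 < Re z \<and> Re z < 0))"
proof -
  let ?L = "ehrhart_poly P"
  have poly: "polytope P" "aff_dim P = 3"
    using assms(1) by (simp_all add: reflexive_polytope_def lattice_polytope_def)
  note cpt = polytope_imp_compact[OF poly(1)] and cvx = polytope_imp_convex[OF poly(1)]
  have vol: "measure lborel P = of_int (\<delta>1 + 1) / 3"
    using measure_palindromic[OF cpt negligible_convex_frontier[OF cvx] assms(2)] .
  then have pos: "\<delta>1 + 1 > 0"
    using measure_pos_convex_full_dim[OF cpt cvx] poly(2) by simp
  have count: "int (card (P \<inter> integer_lattice)) = \<delta>1 + 4"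
    using lattice_point_count_palindromic[OF assms(2), of 1] by (simp add: lattice_point_count_def)
  \<comment> \<open>\<open>c\<close> is the product of the two roots of
    \<open>z ^ 2 + z + c\<close>, whose discriminant is \<open>1 - 4 * c\<close>.\<close>
  define c where "c = 6 / real_of_int (\<delta>1 + 1)"
  have c: "c > 0"
    using pos by (simp add: c_def)
  have c_le: "4 * c \<le> 1 \<longleftrightarrow> \<delta>1 \<ge> 23" and c_ge: "4 * c \<ge> 1 \<longleftrightarrow> \<delta>1 \<le> 23"
    using pos by (simp_all add: c_def field_simps)
  have root: "proots ?L = {#- 1 / 2, r, - 1 - r#}" if "r * (1 + r) = - of_real c" for r
  proof (rule proots_ehrhart_poly_palindromic[OF assms(2)])
    show "\<delta>1 \<noteq> -1"
      using pos by simp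
    have "r * (1 + r) * of_int (\<delta>1 + 1) = - of_real (c * of_int (\<delta>1 + 1))"
      using that by simp
    also have "c * of_int (\<delta>1 + 1) = 6"
      using pos by (simp add: c_def del: of_int_add)
    finally show "r * (1 + r) * of_int (\<delta>1 + 1) = - 6"
      by simp
  qed
  have case_i: "\<exists>b::real. proots ?L = {#- 1 / 2, - 1 / 2 + of_real b * \<i>, - 1 / 2 - of_real b * \<i>#}"
    if "\<delta>1 \<le> 23"
  proof -
    \<comment> \<open>With \<open>z = - 1 / 2 + w\<close> the equation
      \<open>z * (1 + z) = - c\<close> becomes \<open>w ^ 2 = 1 / 4 - c\<close>; here
      \<open>w\<close> is purely imaginary.\<close>
    define b where "b = sqrt (c - 1 / 4)"
    have "b ^ 2 = c - 1 / 4"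
      using that c_ge by (simp add: b_def)
    then have "(- 1 / 2 + of_real b * \<i>) * (1 + (- 1 / 2 + of_real b * \<i>)) = - of_real c"
      by (simp add: complex_eq_iff power2_eq_square algebra_simps)
    from root[OF this] show ?thesis
      by (intro exI[of _ b]) (simp add: algebra_simps)
  qed
  have case_ii: "\<exists>a::real. proots ?L = {#- 1 / 2, of_real a, - 1 - of_real a#}" if "\<delta>1 \<ge> 23"
  proof -
    \<comment> \<open>The same substitution, now with a real square root.\<close>
    define a where "a = - 1 / 2 + sqrt (1 / 4 - c)"
    have "(a + 1 / 2) ^ 2 = 1 / 4 - c"
      using that c_le by (simp add: a_def)
    then have "a * (1 + a) = - c"
      by (simp add: power2_eq_square algebra_simps)
    then have "of_real a * (1 + of_real a) = (- of_real c :: complex)"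
      by (metis of_real_1 of_real_add of_real_minus of_real_mult)
    from root[OF this] show ?thesis
      by blast
  qed
  \<comment> \<open>A complex square root gives a root for either sign of the discriminant. The
    converse directions need this, since there the size of \<open>\<delta>1\<close> is not yet
    known.\<close>
  obtain r where r: "r * (1 + r) = - complex_of_real c"
  proof -
    define r where "r = - 1 / 2 + csqrt (1 / 4 - of_real c)"
    have "r * (1 + r) = (csqrt (1 / 4 - of_real c)) ^ 2 - 1 / 4"
      by (simp add: r_def algebra_simps power2_eq_square)
    then show ?thesis
      using that by simp
  qed
  \<comment> \<open>The zero polynomial has empty \<open>proots\<close>, so a nonempty multiset of
    roots excludes it.\<close>
  have L0: "?L \<noteq> 0"
    using root[OF r] by auto
  have roots: "poly ?L z = 0 \<longleftrightarrow> z \<in># proots ?L" for z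
    using L0 by simp
  have quad: "z = - 1 / 2 \<or> z * (1 + z) = - of_real c" if "z \<in># proots ?L" for z
  proof -
    have "z = - 1 / 2 \<or> z = r \<or> z = - 1 - r"
      using that root[OF r] by simp
    moreover have "(- 1 - r) * (1 + (- 1 - r)) = r * (1 + r)"
      by (simp add: algebra_simps)
    ultimately show ?thesis
      using r by metis
  qed
  have CL: "CL_polytope P \<longleftrightarrow> \<delta>1 \<le> 23"
  proof
    assume "CL_polytope P"
    then have "Re r = - 1 / 2"
      using root[OF r] roots by (auto simp: CL_polytope_def)
    \<comment> \<open>This is the real part of \<open>r * (1 + r) = - c\<close> at
      \<open>Re r = - 1 / 2\<close>.\<close>
    then have "c = 1 / 4 + Im r ^ 2"
      using r by (simp add: complex_eq_iff power2_eq_square)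
    then show "\<delta>1 \<le> 23"
      using c_ge by simp
  next
    assume "\<delta>1 \<le> 23"
    from case_i[OF this] show "CL_polytope P"
      unfolding CL_polytope_def roots by auto
  qed
  have real: "real_polytope P \<longleftrightarrow> \<delta>1 \<ge> 23"
  proof
    assume "real_polytope P"
    then have "Im r = 0"
      using root[OF r] roots by (auto simp: real_polytope_def)
    then have "(Re r + 1 / 2) ^ 2 = 1 / 4 - c"
      using r by (simp add: complex_eq_iff power2_eq_square algebra_simps)
    then have "1 / 4 - c \<ge> 0"
      by (metis zero_le_power2)
    then show "\<delta>1 \<ge> 23"
      using c_le by simp
  next
    assume "\<delta>1 \<ge> 23"
    from case_ii[OF this] show "real_polytope P"
      unfolding real_polytope_def roots by auto
  qed
  have i_CL: "CL_polytope P"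
    if "\<exists>b::real. proots ?L = {#- 1 / 2, - 1 / 2 + of_real b * \<i>, - 1 / 2 - of_real b * \<i>#}"
    using that unfolding CL_polytope_def roots by auto
  have ii_real: "real_polytope P"
    if "\<exists>a::real. proots ?L = {#- 1 / 2, of_real a, - 1 - of_real a#}"
    using that unfolding real_polytope_def roots by auto
  \<comment> \<open>Here \<open>a\<close> is arbitrary and not tied to \<open>r\<close>. Membership
    in the root multiset leaves either \<open>a = - 1 / 2\<close> or
    \<open>a * (1 + a) = - c < 0\<close>, and a negative product places \<open>a\<close> between -1
    and 0.\<close>
  have bounds: "- 1 < a \<and> a < 0" if "proots ?L = {#- 1 / 2, of_real a, - 1 - of_real a#}" for a :: real
  proof -
    have "of_real a = (- 1 / 2 :: complex) \<or> of_real a * (1 + of_real a) = (- of_real c :: complex)"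
      by (rule quad) (simp add: that)
    then have "a = - 1 / 2 \<or> a * (1 + a) = - c"
      by (simp add: complex_eq_iff)
    then show ?thesis
    proof
      assume "a * (1 + a) = - c"
      then have "a * (1 + a) < 0"
        using c by simp
      then show ?thesis
        by (auto simp: mult_less_0_iff)
    qed simp
  qed
  have "- 1 < Re z \<and> Re z < 0"
    if "\<exists>a::real. proots ?L = {#- 1 / 2, of_real a, - 1 - of_real a#}" "poly ?L z = 0" for z
    using that bounds unfolding roots by auto
  \<comment> \<open>At \<open>\<delta>1 = 23\<close> the volume is 24 / 3 = 8 and the count is 23 +
    4 = 27; both increase with \<open>\<delta>1\<close>.\<close>
  moreover have "measure lborel P \<le> 8 \<longleftrightarrow> \<delta>1 \<le> 23" "measure lborel P \<ge> 8 \<longleftrightarrow> \<delta>1 \<ge> 23"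
    "card (P \<inter> integer_lattice) \<le> 27 \<longleftrightarrow> \<delta>1 \<le> 23" "card (P \<inter> integer_lattice) \<ge> 27 \<longleftrightarrow> \<delta>1 \<ge> 23"
    using vol count by (simp_all, linarith+)
  ultimately show ?thesis
    unfolding Let_def using case_i case_ii i_CL ii_real CL real bounds
    by (meson linorder_le_cases)
qed

end
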